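(* (Soundness of the contextual denotation.) For every typing context $\Gamma$, term $r$, type $A$ and valuation $\varsigma$: if $\Gamma\vdash r:A$ and $\Gamma\vdash\varsigma$, then $[\![r]\!]_\varsigma\in[\![A]\!]$.
   Context: Contextual modal type system. Fix disjoint countably infinite sets $\mathbb A$ of atoms and $\mathbb X$ of unknowns. Types: $A::=o\mid\mathbb N\mid A\to A\mid [A_1,\dots,A_n]A$ ($n\ge0$). Fix a set of constants $C$ each with type $\mathrm{type}(C)$, including $\top:o$, $\bot:o$ and, for each type $A$, $\mathrm{isapp}_A:[\,]A\to o$. Terms: $r::=C\mid a\mid\lambda a{:}A.r\mid rr\mid [a_1{:}A_1,\dots,a_n{:}A_n]r\mid X@(r_1,\dots,r_n)\mid \mathrm{letbox}\ X=s\ \mathrm{in}\ r$; $\lambda a{:}A.r$ binds $a$, $[a_i{:}A_i]r$ binds $a_1,\dots,a_n$, and letbox binds $X$ in $r$; terms up to $\alpha$-equivalence. Free atoms: $\mathrm{fa}(C)=\emptyset$, $\mathrm{fa}(a)=\{a\}$, $\mathrm{fa}(\lambda a{:}A.r)=\mathrm{fa}(r)\setminus\{a\}$, $\mathrm{fa}(rs)=\mathrm{fa}(r)\cup\mathrm{fa}(s)$, $\mathrm{fa}([a_i{:}A_i]_1^nr)=\mathrm{fa}(r)\setminus\{a_1,\dots,a_n\}$, $\mathrm{fa}(\mathrm{letbox}\ X=s\ \mathrm{in}\ r)=\mathrm{fa}(r)\cup\mathrm{fa}(s)$, $\mathrm{fa}(X@(s_i)_i)=\bigcup_i\mathrm{fa}(s_i)$.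 Free unknowns: $\mathrm{fv}(C)=\mathrm{fv}(a)=\emptyset$, $\mathrm{fv}(\lambda a{:}A.r)=\mathrm{fv}([a_i{:}A_i]r)=\mathrm{fv}(r)$, $\mathrm{fv}(rs)=\mathrm{fv}(r)\cup\mathrm{fv}(s)$, $\mathrm{fv}(\mathrm{letbox}\ X=s\ \mathrm{in}\ r)=(\mathrm{fv}(r)\setminus\{X\})\cup\mathrm{fv}(s)$, $\mathrm{fv}(X@(s_i)_i)=\{X\}\cup\bigcup_i\mathrm{fv}(s_i)$. A typing context $\Gamma$ is a finite partial function from $\mathbb A\cup\mathbb X$ to types (unknowns receive contextual types). Typing rules: (Hyp) $\Gamma,a{:}A\vdash a:A$; (Const) $\Gamma\vdash C:\mathrm{type}(C)$; (${\to}$I) from $\Gamma,a{:}A\vdash r:B$ infer $\Gamma\vdash\lambda a{:}A.r:A\to B$; (${\to}$E) from $\Gamma\vdash r':A\to B$, $\Gamma\vdash r:A$ infer $\Gamma\vdash r'r:B$; ([]I) from $\Gamma,a_1{:}A_1,\dots,a_n{:}A_n\vdash r:A$ and $\mathrm{fa}(r)\subseteq\{a_1,\dots,a_n\}$ infer $\Gamma\vdash[a_i{:}A_i]r:[A_i]A$; ([]E) from $\Gamma,X{:}[A_i]A\vdash r:B$ and $\Gamma\vdash s:[A_i]A$ infer $\Gamma\vdash\mathrm{letbox}\ X=s\ \mathrm{in}\ r:B$; (Ext) if $\Gamma,X{:}[A_1,\dots,A_n]A\vdash r_j:A_j$ for $1\le j\le n$ then $\Gamma,X{:}[A_1,\dots,A_n]A\vdash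 X@(r_1,\dots,r_n):A$. Substitutions: an atoms-substitution $\sigma$ is a finite partial map $\mathbb A\to$ terms, $\mathrm{fa}(\sigma)=\mathrm{dom}\sigma\cup\bigcup_{a}\mathrm{fa}(\sigma(a))$; action: $C\sigma=C$, $a\sigma=\sigma(a)$ if $a\in\mathrm{dom}\sigma$ else $a$, $(rs)\sigma=(r\sigma)(s\sigma)$, $(X@(r_i))\sigma=X@(r_i\sigma)$, $(\lambda c{:}A.r)\sigma=\lambda c{:}A.(r\sigma)$ ($c\notin\mathrm{fa}(\sigma)$), $([a_i{:}A_i]r)\sigma=[a_i{:}A_i](r\sigma)$ ($a_i\notin\mathrm{fa}(\sigma)$), $(\mathrm{letbox}\ Y=s\ \mathrm{in}\ r)\sigma=\mathrm{letbox}\ Y=s\sigma\ \mathrm{in}\ r\sigma$. An unknowns-substitution $\theta$ is a finite partial map $\mathbb X\to$ terms with each $\theta(X)=[a_1{:}A_1,\dots,a_n{:}A_n]r$, $\mathrm{fa}(r)\subseteq\{a_1,\dots,a_n\}$; action: $C\theta=C$, $a\theta=a$, $(rs)\theta=(r\theta)(s\theta)$, $([a_i{:}A_i]r)\theta=[a_i{:}A_i](r\theta)$, $(\lambda c{:}A.r)\theta=\lambda c{:}A.(r\theta)$, $(X@(r_i)_i)\theta=s'[a_i{:=}r_i\theta]_i$ (simultaneous atoms-substitution) if $\theta(X)=[a_i{:}A_i]s'$ with matching arity, $(X@(r_i))\theta=X@(r_i\theta)$ if $X\notin\mathrm{dom}\theta$, $(\mathrm{letbox}\ Y=s\ \mathrm{in}\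 r)\theta=\mathrm{letbox}\ Y=s\theta\ \mathrm{in}\ r\theta$ ($Y\notin\mathrm{fv}(\theta)$). Denotation: $[\![o]\!]=\{\top,\bot\}$, $[\![\mathbb N]\!]=\mathbb N$, $[\![A\to B]\!]$ = all functions $[\![A]\!]\to[\![B]\!]$, $[\![[A_1,\dots,A_n]A]\!]=\{[a_i{:}A_i]_1^nr\mid\emptyset\vdash[a_i{:}A_i]_1^nr:[A_i]_1^nA\}\times(\text{all functions }\prod_{i=1}^n[\![A_i]\!]\to[\![A]\!])$; pairs written $h::f$ with $\mathrm{hd}$, $\mathrm{tl}$ the projections. A valuation $\varsigma$ is a finite partial function on $\mathbb A\cup\mathbb X$; $\Gamma\vdash\varsigma$ means $\mathrm{dom}\Gamma=\mathrm{dom}\varsigma$, $\varsigma(a)\in[\![\Gamma(a)]\!]$ and $\varsigma(X)\in[\![\Gamma(X)]\!]$. $\varsigma_{\mathbb X}$ is the unknowns-substitution $X\mapsto\mathrm{hd}(\varsigma(X))$. Each other constant $C$ has a fixed $C^{[\![]\!]}\in[\![\mathrm{type}(C)]\!]$. Terms: $[\![\top]\!]_\varsigma=\top$, $[\![\bot]\!]_\varsigma=\bot$, $[\![C]\!]_\varsigma=C^{[\![]\!]}$, $[\![a]\!]_\varsigma=\varsigma(a)$, $[\![\lambda a{:}A.r]\!]_\varsigma=(x\mapsto[\![r]\!]_{\varsigma[a:=x]})$, $[\![r'r]\!]_\varsigma=[\![r']\!]_\varsigma([\![r]\!]_\varsigma)$, $[\![[a_i{:}A_i]_1^nr]\!]_\varsigma=[a_i{:}A_i]_1^n(r\varsigma_{\mathbb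 X})::\big((x_i\in[\![A_i]\!])_1^n\mapsto[\![r]\!]_{\varsigma[a_i:=x_i]_1^n}\big)$, $[\![X@(r_i)_1^n]\!]_\varsigma=\mathrm{tl}(\varsigma(X))([\![r_1]\!]_\varsigma,\dots,[\![r_n]\!]_\varsigma)$, $[\![\mathrm{letbox}\ X=s\ \mathrm{in}\ r]\!]_\varsigma=[\![r]\!]_{\varsigma[X:=[\![s]\!]_\varsigma]}$, and $[\![\mathrm{isapp}_A]\!]$ maps $[a_i{:}A_i](r'r'')::f$ to $\top$ and every other element to $\bot$. *)

theory Defs
  imports Main
begin

section \<open>Syntax\<close>

datatype atom = Atom nat
datatype unknown = Unknown nat

datatype ty =
    TyO
  | TyN
  | TyFun ty ty
  | TyBox "ty list" ty

text \<open>The type parameter \<open>'c\<close> collects the constants other than the three obligatory ones.\<close>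

datatype 'c const = CTop | CBot | CIsapp ty | COther 'c

fun const_type :: "('c \<Rightarrow> ty) \<Rightarrow> 'c const \<Rightarrow> ty" where
  "const_type tp CTop = TyO"
| "const_type tp CBot = TyO"
| "const_type tp (CIsapp A) = TyFun (TyBox [] A) TyO"
| "const_type tp (COther c) = tp c"

text \<open>
  Terms up to alpha-equivalence, in locally nameless form: free atoms and unknowns are names,
  bound ones are indices. \<open>BAtom k i\<close> is the \<open>i\<close>-th atom bound by the \<open>k\<close>-th enclosing
  \<open>LAM\<close> or \<open>BOX\<close>; \<open>UBound k\<close> is the unknown bound by the \<open>k\<close>-th enclosing \<open>LET\<close>.
  \<open>LET s r\<close> binds in \<open>r\<close> only. Alpha-equivalence classes are the terms without dangling indices,
  i.e. those generated by the free-name constructors and by \<open>lam\<close>, \<open>box\<close>, \<open>letbox\<close> below;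
  every typable term is of this kind.
\<close>

datatype uref = UFree unknown | UBound nat

datatype 'c trm =
    Const "'c const"
  | FAtom atom
  | BAtom nat nat
  | LAM ty "'c trm"
  | App "'c trm" "'c trm"
  | BOX "ty list" "'c trm"
  | UApp uref "'c trm list"
  | LET "'c trm" "'c trm"

primrec fa :: "'c trm \<Rightarrow> atom set" where
  "fa (Const c) = {}"
| "fa (FAtom a) = {a}"
| "fa (BAtom k i) = {}"
| "fa (LAM A r) = fa r"
| "fa (App r s) = fa r \<union> fa s"
| "fa (BOX As r) = fa r"
| "fa (UApp u rs) = \<Union> (set (map fa rs))"
| "fa (LET s r) = fa r \<union> fa s"

primrec fv :: "'c trm \<Rightarrow> unknown set" where
  "fv (Const c) = {}"
| "fv (FAtom a) = {}"
| "fv (BAtom k i) = {}"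
| "fv (LAM A r) = fv r"
| "fv (App r s) = fv r \<union> fv s"
| "fv (BOX As r) = fv r"
| "fv (UApp u rs) = (case u of UFree X \<Rightarrow> {X} | UBound k \<Rightarrow> {}) \<union> \<Union> (set (map fv rs))"
| "fv (LET s r) = fv r \<union> fv s"

text \<open>\<open>aopen 0 as r\<close> names the atoms bound by a removed binder around \<open>r\<close>;
  \<open>aclose 0 as r\<close> turns the free atoms \<open>as\<close> into bound ones; likewise for unknowns.\<close>

primrec aopen :: "nat \<Rightarrow> atom list \<Rightarrow> 'c trm \<Rightarrow> 'c trm" where
  "aopen k as (Const c) = Const c"
| "aopen k as (FAtom a) = FAtom a"
| "aopen k as (BAtom j i) = (if j = k \<and> i < length as then FAtom (as ! i) else BAtom j i)"
| "aopen k as (LAM A r) = LAM A (aopen (Suc k) as r)"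
| "aopen k as (App r s) = App (aopen k as r) (aopen k as s)"
| "aopen k as (BOX As r) = BOX As (aopen (Suc k) as r)"
| "aopen k as (UApp u rs) = UApp u (map (aopen k as) rs)"
| "aopen k as (LET s r) = LET (aopen k as s) (aopen k as r)"

primrec aclose :: "nat \<Rightarrow> atom list \<Rightarrow> 'c trm \<Rightarrow> 'c trm" where
  "aclose k as (Const c) = Const c"
| "aclose k as (FAtom a) =
     (case map_of (zip as [0..<length as]) a of None \<Rightarrow> FAtom a | Some i \<Rightarrow> BAtom k i)"
| "aclose k as (BAtom j i) = BAtom j i"
| "aclose k as (LAM A r) = LAM A (aclose (Suc k) as r)"
| "aclose k as (App r s) = App (aclose k as r) (aclose k as s)"
| "aclose k as (BOX As r) = BOX As (aclose (Suc k) as r)"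
| "aclose k as (UApp u rs) = UApp u (map (aclose k as) rs)"
| "aclose k as (LET s r) = LET (aclose k as s) (aclose k as r)"

primrec uopen :: "nat \<Rightarrow> unknown \<Rightarrow> 'c trm \<Rightarrow> 'c trm" where
  "uopen k X (Const c) = Const c"
| "uopen k X (FAtom a) = FAtom a"
| "uopen k X (BAtom j i) = BAtom j i"
| "uopen k X (LAM A r) = LAM A (uopen k X r)"
| "uopen k X (App r s) = App (uopen k X r) (uopen k X s)"
| "uopen k X (BOX As r) = BOX As (uopen k X r)"
| "uopen k X (UApp u rs) = UApp (if u = UBound k then UFree X else u) (map (uopen k X) rs)"
| "uopen k X (LET s r) = LET (uopen k X s) (uopen (Suc k) X r)"

primrec uclose :: "nat \<Rightarrow> unknown \<Rightarrow> 'c trm \<Rightarrow> 'c trm" where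
  "uclose k X (Const c) = Const c"
| "uclose k X (FAtom a) = FAtom a"
| "uclose k X (BAtom j i) = BAtom j i"
| "uclose k X (LAM A r) = LAM A (uclose k X r)"
| "uclose k X (App r s) = App (uclose k X r) (uclose k X s)"
| "uclose k X (BOX As r) = BOX As (uclose k X r)"
| "uclose k X (UApp u rs) = UApp (if u = UFree X then UBound k else u) (map (uclose k X) rs)"
| "uclose k X (LET s r) = LET (uclose k X s) (uclose (Suc k) X r)"

definition lam :: "atom \<Rightarrow> ty \<Rightarrow> 'c trm \<Rightarrow> 'c trm" where
  "lam a A r = LAM A (aclose 0 [a] r)"

definition box :: "atom list \<Rightarrow> ty list \<Rightarrow> 'c trm \<Rightarrow> 'c trm" where
  "box as As r = BOX As (aclose 0 as r)"

definition letbox :: "unknown \<Rightarrow> 'c trm \<Rightarrow> 'c trm \<Rightarrow> 'c trm" where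
  "letbox X s r = LET s (uclose 0 X r)"

lemma map_of_zip_upt_Some: "map_of (zip as [0..<length as]) a = Some i \<Longrightarrow> a \<in> set as"
  by (metis map_of_SomeD set_zip_leftD)

lemma fa_aclose: "fa (aclose k as r) = fa r - set as"
proof (induction r arbitrary: k)
  case (FAtom a)
  then show ?case
    by (auto split: option.split dest: map_of_zip_upt_Some)
qed auto

lemma fv_aclose: "fv (aclose k as r) = fv r"
  by (induction r arbitrary: k) (auto split: option.split)

lemma fa_uclose: "fa (uclose k X r) = fa r"
  by (induction r arbitrary: k) auto

lemma fv_uclose: "fv (uclose k X r) = fv r - {X}"
  by (induction r arbitrary: k) (auto split: uref.splits)

lemma fa_binders:
  "fa (lam a A r) = fa r - {a}"
  "fa (box as As r) = fa r - set as"
  "fa (letbox X s r) = fa r \<union> fa s"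
  by (simp_all add: lam_def box_def letbox_def fa_aclose fa_uclose)

lemma fv_binders:
  "fv (lam a A r) = fv r"
  "fv (box as As r) = fv r"
  "fv (letbox X s r) = (fv r - {X}) \<union> fv s"
  by (simp_all add: lam_def box_def letbox_def fv_aclose fv_uclose)


section \<open>Typing\<close>

type_synonym ctxt = "atom + unknown \<rightharpoonup> ty"

definition is_ctxt :: "ctxt \<Rightarrow> bool" where
  "is_ctxt \<Gamma> \<longleftrightarrow> finite (dom \<Gamma>) \<and> (\<forall>X B. \<Gamma> (Inr X) = Some B \<longrightarrow> (\<exists>As A. B = TyBox As A))"

text \<open>
  \<open>typing_in T\<close> is typability by a derivation in which every type at which a function or an unknown
  is applied lies in \<open>T\<close>; \<open>typing\<close> (the case \<open>T = UNIV\<close>) is the plain typing judgement.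
  The set \<open>T\<close> delimits the types whose function spaces the universe of values must accommodate,
  see \<open>represents\<close> below.
  Context extension is update, so a bound name may shadow one already in the context.
\<close>

inductive typing_in :: "ty set \<Rightarrow> ('c \<Rightarrow> ty) \<Rightarrow> ctxt \<Rightarrow> 'c trm \<Rightarrow> ty \<Rightarrow> bool"
  for T :: "ty set" and tp :: "'c \<Rightarrow> ty"
where
  Hyp: "\<Gamma> (Inl a) = Some A \<Longrightarrow> typing_in T tp \<Gamma> (FAtom a) A"
| Const: "typing_in T tp \<Gamma> (Const c) (const_type tp c)"
| FunI: "typing_in T tp (\<Gamma>(Inl a \<mapsto> A)) r B \<Longrightarrow> typing_in T tp \<Gamma> (lam a A r) (TyFun A B)"
| FunE: "typing_in T tp \<Gamma> r' (TyFun A B) \<Longrightarrow> typing_in T tp \<Gamma> r A \<Longrightarrow> TyFun A B \<in> T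
    \<Longrightarrow> typing_in T tp \<Gamma> (App r' r) B"
| BoxI: "distinct as \<Longrightarrow> length as = length As
    \<Longrightarrow> typing_in T tp (\<Gamma>(map Inl as [\<mapsto>] As)) r A \<Longrightarrow> fa r \<subseteq> set as
    \<Longrightarrow> typing_in T tp \<Gamma> (box as As r) (TyBox As A)"
| BoxE: "typing_in T tp (\<Gamma>(Inr X \<mapsto> TyBox As A)) r B \<Longrightarrow> typing_in T tp \<Gamma> s (TyBox As A)
    \<Longrightarrow> typing_in T tp \<Gamma> (letbox X s r) B"
| Ext: "\<Gamma> (Inr X) = Some (TyBox As A) \<Longrightarrow> length rs = length As
    \<Longrightarrow> (\<And>j. j < length As \<Longrightarrow> typing_in T tp \<Gamma> (rs ! j) (As ! j)) \<Longrightarrow> TyBox As A \<in> T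
    \<Longrightarrow> typing_in T tp \<Gamma> (UApp (UFree X) rs) A"

abbreviation typing :: "('c \<Rightarrow> ty) \<Rightarrow> ctxt \<Rightarrow> 'c trm \<Rightarrow> ty \<Rightarrow> bool" where
  "typing \<equiv> typing_in UNIV"

lemma typing_in_mono: "typing_in T tp \<Gamma> r A \<Longrightarrow> T \<subseteq> T' \<Longrightarrow> typing_in T' tp \<Gamma> r A"
  by (induction rule: typing_in.induct) (blast intro: typing_in.intros)+

lemma typing_imp_finite: "typing tp \<Gamma> r A \<Longrightarrow> \<exists>T. finite T \<and> typing_in T tp \<Gamma> r A"
proof (induction rule: typing_in.induct)
  case (FunE \<Gamma> r' A B r)
  then obtain T1 T2 where "finite T1" "typing_in T1 tp \<Gamma> r' (TyFun A B)"
    "finite T2" "typing_in T2 tp \<Gamma> r A"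
    by blast
  then show ?case
    by (intro exI[of _ "insert (TyFun A B) (T1 \<union> T2)"] conjI typing_in.FunE[where A = A])
      (auto elim: typing_in_mono)
next
  case (BoxE \<Gamma> X As A r B s)
  then obtain T1 T2 where "finite T1" "typing_in T1 tp (\<Gamma>(Inr X \<mapsto> TyBox As A)) r B"
    "finite T2" "typing_in T2 tp \<Gamma> s (TyBox As A)"
    by blast
  then show ?case
    by (intro exI[of _ "T1 \<union> T2"] conjI typing_in.BoxE[where As = As and A = A])
      (auto elim: typing_in_mono)
next
  case (Ext \<Gamma> X As A rs)
  then obtain F where F: "\<And>j. j < length As \<Longrightarrow> finite (F j) \<and> typing_in (F j) tp \<Gamma> (rs ! j) (As ! j)"
    by metis
  show ?case
  proof (intro exI[of _ "insert (TyBox As A) (\<Union>j<length As. F j)"] conjI typing_in.Ext[where As = As])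
    fix j assume "j < length As"
    then show "typing_in (insert (TyBox As A) (\<Union>j<length As. F j)) tp \<Gamma> (rs ! j) (As ! j)"
      using F by (blast intro: typing_in_mono)
  qed (use F Ext.hyps in auto)
qed (blast intro: typing_in.intros)+


section \<open>Substitution\<close>

text \<open>Since bound names are indices, the freshness side conditions hold automatically.\<close>

primrec asubst :: "(atom \<rightharpoonup> 'c trm) \<Rightarrow> 'c trm \<Rightarrow> 'c trm" where
  "asubst \<sigma> (Const c) = Const c"
| "asubst \<sigma> (FAtom a) = (case \<sigma> a of None \<Rightarrow> FAtom a | Some t \<Rightarrow> t)"
| "asubst \<sigma> (BAtom k i) = BAtom k i"
| "asubst \<sigma> (LAM A r) = LAM A (asubst \<sigma> r)"
| "asubst \<sigma> (App r s) = App (asubst \<sigma> r) (asubst \<sigma> s)"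
| "asubst \<sigma> (BOX As r) = BOX As (asubst \<sigma> r)"
| "asubst \<sigma> (UApp u rs) = UApp u (map (asubst \<sigma>) rs)"
| "asubst \<sigma> (LET s r) = LET (asubst \<sigma> s) (asubst \<sigma> r)"

definition fa_sub :: "(atom \<rightharpoonup> 'c trm) \<Rightarrow> atom set" where
  "fa_sub \<sigma> = dom \<sigma> \<union> (\<Union>t\<in>ran \<sigma>. fa t)"

lemma aclose_fresh: "fa r \<inter> set as = {} \<Longrightarrow> aclose k as r = r"
proof (induction r arbitrary: k)
  case (FAtom a)
  then show ?case
    by (auto split: option.split dest: map_of_zip_upt_Some)
next
  case (UApp u rs)
  then have "aclose k as r = r" if "r \<in> set rs" for r
    using that by fastforce
  then show ?case by (simp add: map_idI)
qed (simp_all add: Int_Un_distrib2)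

lemma asubst_aclose:
  assumes "set as \<inter> fa_sub \<sigma> = {}"
  shows "asubst \<sigma> (aclose k as r) = aclose k as (asubst \<sigma> r)"
proof (induction r arbitrary: k)
  case (FAtom a)
  show ?case
  proof (cases "\<sigma> a")
    case None
    then show ?thesis by (simp split: option.split)
  next
    case (Some t)
    then have "a \<notin> set as" "fa t \<inter> set as = {}"
      using assms by (auto simp: fa_sub_def ran_def)
    then show ?thesis
      using Some by (auto simp: aclose_fresh split: option.split dest: map_of_zip_upt_Some)
  qed
qed auto

lemma asubst_binders:
  "c \<notin> fa_sub \<sigma> \<Longrightarrow> asubst \<sigma> (lam c A r) = lam c A (asubst \<sigma> r)"
  "set as \<inter> fa_sub \<sigma> = {} \<Longrightarrow> asubst \<sigma> (box as As r) = box as As (asubst \<sigma> r)"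
  by (simp_all add: lam_def box_def asubst_aclose)

definition fresh_atoms :: "nat \<Rightarrow> atom set \<Rightarrow> atom list" where
  "fresh_atoms n S = (SOME as. distinct as \<and> length as = n \<and> set as \<inter> S = {})"

definition fresh_unknown :: "unknown set \<Rightarrow> unknown" where
  "fresh_unknown S = (SOME X. X \<notin> S)"

text \<open>A size that, unlike the generated one, is invariant under opening.\<close>

primrec tsize :: "'c trm \<Rightarrow> nat" where
  "tsize (Const c) = 1"
| "tsize (FAtom a) = 1"
| "tsize (BAtom k i) = 1"
| "tsize (LAM A r) = Suc (tsize r)"
| "tsize (App r s) = Suc (tsize r + tsize s)"
| "tsize (BOX As r) = Suc (tsize r)"
| "tsize (UApp u rs) = Suc (sum_list (map tsize rs))"
| "tsize (LET s r) = Suc (tsize s + tsize r)"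

lemma tsize_aopen [simp]: "tsize (aopen k as r) = tsize r"
  by (induction r arbitrary: k) (auto simp: o_def intro!: arg_cong[where f = sum_list])

lemma tsize_uopen [simp]: "tsize (uopen k X r) = tsize r"
  by (induction r arbitrary: k) (auto simp: o_def intro!: arg_cong[where f = sum_list])

lemma tsize_arg: "r \<in> set rs \<Longrightarrow> tsize r < Suc (sum_list (map tsize rs))"
  by (simp add: less_Suc_eq_le member_le_sum_list)

definition is_usubst :: "(unknown \<rightharpoonup> 'c trm) \<Rightarrow> bool" where
  "is_usubst \<theta> \<longleftrightarrow> finite (dom \<theta>) \<and>
     (\<forall>X t. \<theta> X = Some t \<longrightarrow>
        (\<exists>as As r. distinct as \<and> length as = length As \<and> t = box as As r \<and> fa r \<subseteq> set as))"

definition fv_sub :: "(unknown \<rightharpoonup> 'c trm) \<Rightarrow> unknown set" where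
  "fv_sub \<theta> = dom \<theta> \<union> (\<Union>t\<in>ran \<theta>. fv t)"

text \<open>
  The clauses for binders pick a representative of the alpha-class with sufficiently fresh
  bound names. On an arity mismatch at an unknown, where the action is unspecified, the unknown
  is left in place.
\<close>

function usubst :: "(unknown \<rightharpoonup> 'c trm) \<Rightarrow> 'c trm \<Rightarrow> 'c trm" where
  "usubst \<theta> (Const c) = Const c"
| "usubst \<theta> (FAtom a) = FAtom a"
| "usubst \<theta> (BAtom k i) = BAtom k i"
| "usubst \<theta> (LAM A r) =
     (let as = fresh_atoms 1 (fa r) in lam (hd as) A (usubst \<theta> (aopen 0 as r)))"
| "usubst \<theta> (App r s) = App (usubst \<theta> r) (usubst \<theta> s)"
| "usubst \<theta> (BOX As r) =
     (let as = fresh_atoms (length As) (fa r) in box as As (usubst \<theta> (aopen 0 as r)))"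
| "usubst \<theta> (UApp u rs) =
     (let rs' = map (usubst \<theta>) rs in
      case u of
        UBound k \<Rightarrow> UApp u rs'
      | UFree X \<Rightarrow>
          (case \<theta> X of
             Some (BOX As s) \<Rightarrow>
               (if length As = length rs
                then let as = fresh_atoms (length As) (fa s)
                     in asubst [as [\<mapsto>] rs'] (aopen 0 as s)
                else UApp u rs')
           | _ \<Rightarrow> UApp u rs'))"
| "usubst \<theta> (LET s r) =
     (let Y = fresh_unknown (fv r \<union> fv_sub \<theta>) in
      letbox Y (usubst \<theta> s) (usubst \<theta> (uopen 0 Y r)))"
  by pat_completeness auto
termination
  by (relation "measure (\<lambda>(\<theta>, r). tsize r)") (auto simp: tsize_arg)


section \<open>Denotation\<close>

text \<open>
  No closed HOL type provably contains all the iterated full function spaces over the naturals, so values are built over a parameter type \<open>'u\<close> of codes for functions. A set-theoretic function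
  on a product of sets is a partial map on argument lists (singleton lists for ordinary arrows);
  \<open>VFun (code M f)\<close> stands for \<open>f\<close>, and \<open>VBox h (code M f)\<close> for the pair \<open>h :: f\<close>.
\<close>

datatype ('c, 'u) val = VBool bool | VNat nat | VFun 'u | VBox "'c trm" 'u

record ('c, 'u) model =
  code :: "(('c, 'u) val list \<rightharpoonup> ('c, 'u) val) \<Rightarrow> 'u"
  decode :: "'u \<Rightarrow> (('c, 'u) val list \<rightharpoonup> ('c, 'u) val)"
  const_val :: "'c \<Rightarrow> ('c, 'u) val"

definition funs :: "'a set list \<Rightarrow> 'b set \<Rightarrow> ('a list \<rightharpoonup> 'b) set" where
  "funs Ds E = {f. dom f = listset Ds \<and> ran f \<subseteq> E}"

fun ty_den :: "('c \<Rightarrow> ty) \<Rightarrow> ('c, 'u) model \<Rightarrow> ty \<Rightarrow> ('c, 'u) val set" where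
  "ty_den tp M TyO = {VBool True, VBool False}"
| "ty_den tp M TyN = range VNat"
| "ty_den tp M (TyFun A B) = {VFun (code M f) |f. f \<in> funs [ty_den tp M A] (ty_den tp M B)}"
| "ty_den tp M (TyBox As A) =
     {VBox (BOX As r) (code M f) |r f.
        typing tp Map.empty (BOX As r) (TyBox As A) \<and> f \<in> funs (map (ty_den tp M) As) (ty_den tp M A)}"

fun fun_space :: "('c \<Rightarrow> ty) \<Rightarrow> ('c, 'u) model \<Rightarrow> ty \<Rightarrow> (('c, 'u) val list \<rightharpoonup> ('c, 'u) val) set" where
  "fun_space tp M (TyFun A B) = funs [ty_den tp M A] (ty_den tp M B)"
| "fun_space tp M (TyBox As A) = funs (map (ty_den tp M) As) (ty_den tp M A)"
| "fun_space tp M _ = {}"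

text \<open>
  Codes identify functions at all types in \<open>T\<close>, so that there the denotations are the full
  function spaces up to the bijection \<open>code M\<close>. This only demands that \<open>'u\<close> be large enough:
  for finite \<open>T\<close> an iterated power of the naturals suffices if \<open>'c\<close> is countable, while
  \<open>T = UNIV\<close> needs a type with at least \<open>beth_omega\<close> elements, such as a type of ZFC sets.
\<close>

definition represents :: "('c \<Rightarrow> ty) \<Rightarrow> ('c, 'u) model \<Rightarrow> ty set \<Rightarrow> bool" where
  "represents tp M T \<longleftrightarrow> (\<forall>B\<in>T. \<forall>f\<in>fun_space tp M B. decode M (code M f) = f)"

definition const_ok :: "('c \<Rightarrow> ty) \<Rightarrow> ('c, 'u) model \<Rightarrow> bool" where
  "const_ok tp M \<longleftrightarrow> (\<forall>c. const_val M c \<in> ty_den tp M (tp c))"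

type_synonym ('c, 'u) valuation = "atom + unknown \<rightharpoonup> ('c, 'u) val"

definition val_ok :: "('c \<Rightarrow> ty) \<Rightarrow> ('c, 'u) model \<Rightarrow> ctxt \<Rightarrow> ('c, 'u) valuation \<Rightarrow> bool" where
  "val_ok tp M \<Gamma> \<zeta> \<longleftrightarrow> dom \<Gamma> = dom \<zeta> \<and>
     (\<forall>n A v. \<Gamma> n = Some A \<longrightarrow> \<zeta> n = Some v \<longrightarrow> v \<in> ty_den tp M A)"

fun fcode :: "('c, 'u) val \<Rightarrow> 'u" where
  "fcode (VFun u) = u"
| "fcode (VBox h u) = u"
| "fcode _ = undefined"

definition apply_val :: "('c, 'u) model \<Rightarrow> ('c, 'u) val \<Rightarrow> ('c, 'u) val list \<Rightarrow> ('c, 'u) val" where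
  "apply_val M v xs = the (decode M (fcode v) xs)"

definition hd_subst :: "('c, 'u) valuation \<Rightarrow> (unknown \<rightharpoonup> 'c trm)" where
  "hd_subst \<zeta> = (\<lambda>X. case \<zeta> (Inr X) of Some (VBox h u) \<Rightarrow> Some h | _ \<Rightarrow> None)"

fun is_app_box :: "('c, 'u) val \<Rightarrow> bool" where
  "is_app_box (VBox (BOX As (App r' r'')) u) = True"
| "is_app_box _ = False"

definition restrict_fun :: "('a list \<Rightarrow> 'b) \<Rightarrow> 'a set list \<Rightarrow> ('a list \<rightharpoonup> 'b)" where
  "restrict_fun F Ds = (\<lambda>xs. if xs \<in> listset Ds then Some (F xs) else None)"

fun const_den :: "('c \<Rightarrow> ty) \<Rightarrow> ('c, 'u) model \<Rightarrow> 'c const \<Rightarrow> ('c, 'u) val" where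
  "const_den tp M CTop = VBool True"
| "const_den tp M CBot = VBool False"
| "const_den tp M (CIsapp A) =
     VFun (code M (restrict_fun (\<lambda>xs. VBool (is_app_box (hd xs))) [ty_den tp M (TyBox [] A)]))"
| "const_den tp M (COther c) = const_val M c"

text \<open>
  As with substitution, the binder clauses evaluate a representative with fresh bound names;
  for typable terms the choice does not matter.
\<close>

function den :: "('c \<Rightarrow> ty) \<Rightarrow> ('c, 'u) model \<Rightarrow> ('c, 'u) valuation \<Rightarrow> 'c trm \<Rightarrow> ('c, 'u) val" where
  "den tp M \<zeta> (Const c) = const_den tp M c"
| "den tp M \<zeta> (FAtom a) = the (\<zeta> (Inl a))"
| "den tp M \<zeta> (BAtom k i) = undefined"
| "den tp M \<zeta> (LAM A r) =
     (let as = fresh_atoms 1 (fa r) in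
      VFun (code M (restrict_fun (\<lambda>xs. den tp M (\<zeta>(Inl (hd as) \<mapsto> hd xs)) (aopen 0 as r))
        [ty_den tp M A])))"
| "den tp M \<zeta> (App r' r) = apply_val M (den tp M \<zeta> r') [den tp M \<zeta> r]"
| "den tp M \<zeta> (BOX As r) =
     (let as = fresh_atoms (length As) (fa r) in
      VBox (box as As (usubst (hd_subst \<zeta>) (aopen 0 as r)))
        (code M (restrict_fun (\<lambda>xs. den tp M (\<zeta>(map Inl as [\<mapsto>] xs)) (aopen 0 as r))
          (map (ty_den tp M) As))))"
| "den tp M \<zeta> (UApp u rs) =
     (case u of
        UFree X \<Rightarrow> apply_val M (the (\<zeta> (Inr X))) (map (den tp M \<zeta>) rs)
      | UBound k \<Rightarrow> undefined)"
| "den tp M \<zeta> (LET s r) =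
     (let X = fresh_unknown (fv r) in
      den tp M (\<zeta>(Inr X \<mapsto> den tp M \<zeta> s)) (uopen 0 X r))"
  by pat_completeness auto
termination
  by (relation "measure (\<lambda>(tp, M, \<zeta>, r). tsize r)") (auto simp: tsize_arg)

end

theory Submission
  imports Defs
begin

text \<open>
  Typing derivations carry names for bound variables which differ from the fresh names that
  \<open>den\<close> and \<open>usubst\<close> choose. The judgement \<open>ln_typing\<close> removes the names: it types locally nameless
  terms under type lists for the dangling indices, is syntax-directed, and is equivalent to the
  named judgement on terms without dangling indices. Opening a binder with any fresh names is then a
  lemma, and soundness follows by induction on the size of the term. The only clause that is not
  immediate is the intensional part of a box, which needs that substituting closed boxes for all
  unknowns turns a box into a closed one of the same type.
\<close>

section \<open>Fresh names and simultaneous updates\<close>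

lemma finite_fa: "finite (fa r)"
  by (induction r) auto

lemma finite_fv: "finite (fv r)"
  by (induction r) (auto split: uref.splits)

lemma infinite_atoms: "infinite (UNIV :: atom set)"
  using infinite_iff_countable_subset[of "UNIV :: atom set"]
  by (metis atom.inject injI subset_UNIV)

lemma infinite_unknowns: "infinite (UNIV :: unknown set)"
  using infinite_iff_countable_subset[of "UNIV :: unknown set"]
  by (metis unknown.inject injI subset_UNIV)

text \<open>The complement of a finite set of atoms is infinite, so the choice behind
  \<open>fresh_atoms\<close> always succeeds.\<close>

lemma fresh_atoms:
  assumes "finite S"
  shows "distinct (fresh_atoms n S)" "length (fresh_atoms n S) = n" "set (fresh_atoms n S) \<inter> S = {}"
proof -
  have "infinite (- S)"
    using assms infinite_atoms by (simp add: Compl_eq_Diff_UNIV)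
  then obtain B where B: "B \<subseteq> - S" "finite B" "card B = n"
    using infinite_arbitrarily_large by blast
  then obtain as where "set as = B" "distinct as"
    using finite_distinct_list by blast
  then have "\<exists>as. distinct as \<and> length as = n \<and> set as \<inter> S = {}"
    using B distinct_card by fastforce
  then have "distinct (fresh_atoms n S) \<and> length (fresh_atoms n S) = n \<and> set (fresh_atoms n S) \<inter> S = {}"
    unfolding fresh_atoms_def by (rule someI_ex)
  then show "distinct (fresh_atoms n S)" "length (fresh_atoms n S) = n" "set (fresh_atoms n S) \<inter> S = {}"
    by auto
qed

lemma fresh_unknown: "finite S \<Longrightarrow> fresh_unknown S \<notin> S"
  unfolding fresh_unknown_def using ex_new_if_finite[OF infinite_unknowns] by (rule someI_ex)

section \<open>Lookup in simultaneously updated maps\<close>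

lemma map_upds_map_other: "(\<And>x. x \<in> set xs \<Longrightarrow> f x \<noteq> n) \<Longrightarrow> (m(map f xs [\<mapsto>] ys)) n = m n"
  by (rule map_upds_apply_nontin) auto

lemma map_upds_map_nth:
  assumes "inj f" "distinct xs" "length xs = length ys" "i < length ys"
  shows "(m(map f xs [\<mapsto>] ys)) (f (xs ! i)) = Some (ys ! i)"
  using assms(2-4)
proof (induction xs arbitrary: m ys i)
  case (Cons x xs)
  then obtain y ys' where ys: "ys = y # ys'"
    by (cases ys) auto
  show ?case
  proof (cases i)
    case 0
    \<comment> \<open>Later updates override earlier ones; distinctness and injectivity of
      \<open>f\<close> ensure that none of them hits \<open>f x\<close>.\<close>
    have "((m(f x \<mapsto> y))(map f xs [\<mapsto>] ys')) (f x) = (m(f x \<mapsto> y)) (f x)"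
      using Cons.prems(1) assms(1) by (intro map_upds_map_other) (auto dest: injD)
    then show ?thesis
      using 0 ys by simp
  next
    case (Suc j)
    then show ?thesis
      using Cons ys by simp
  qed
qed simp

lemma map_upds_map_Inl_notin: "a \<notin> set xs \<Longrightarrow> (m(map Inl xs [\<mapsto>] ys)) (Inl a) = m (Inl a)"
  by (rule map_upds_map_other) auto

lemma map_upds_map_Inl_Inr: "(m(map Inl xs [\<mapsto>] ys)) (Inr X) = m (Inr X)"
  by (rule map_upds_map_other) auto

text \<open>Both cases quantify over the updated map \<open>m\<close>, so that a single case split
  evaluates several contexts carrying the same update.\<close>

lemma map_upds_map_cases:
  assumes "inj f" "distinct xs" "length xs = length ys"
  obtains (new) i where "i < length ys" "n = f (xs ! i)" "\<And>m. (m(map f xs [\<mapsto>] ys)) n = Some (ys ! i)"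
    | (old) "\<And>x. x \<in> set xs \<Longrightarrow> n \<noteq> f x" "\<And>m. (m(map f xs [\<mapsto>] ys)) n = m n"
proof (cases "n \<in> f ` set xs")
  case True
  then obtain i where "i < length ys" "n = f (xs ! i)"
    using assms(3) by (auto simp: in_set_conv_nth)
  then show thesis
    using new map_upds_map_nth[OF assms] by blast
next
  case False
  then show thesis
    using old map_upds_map_other[of xs f n] by blast
qed

lemma map_of_zip_index:
  assumes "distinct xs" "i < length xs"
  shows "map_of (zip xs [0..<length xs]) (xs ! i) = Some i"
  using map_of_zip_nth[of xs "[0..<length xs]" i] assms by simp

section \<open>Closing undoes opening\<close>

lemma fa_aopen: "fa (aopen k as r) \<subseteq> fa r \<union> set as"
  by (induction r arbitrary: k) (fastforce split: if_splits)+

text \<open>Freshness keeps closing from capturing an atom that was free beforehand, and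
  distinctness makes the position looked up for an opened atom the original index. This is how a
  nameless binder is rewritten as a named one.\<close>

lemma aclose_aopen:
  "distinct as \<Longrightarrow> set as \<inter> fa r = {} \<Longrightarrow> aclose k as (aopen k as r) = r"
proof (induction r arbitrary: k)
  case (FAtom a)
  then show ?case
    using aclose_fresh[of "FAtom a" as k] by (simp add: Int_commute)
next
  case (UApp u rs)
  then have "aclose k as (aopen k as r) = r" if "r \<in> set rs" for r
    using that by fastforce
  then show ?case
    by (simp add: map_idI)
qed (auto simp: map_of_zip_index Int_Un_distrib)

lemma uclose_uopen: "X \<notin> fv r \<Longrightarrow> uclose k X (uopen k X r) = r"
proof (induction r arbitrary: k)
  case (UApp u rs)
  then have "uclose k X (uopen k X r) = r" if "r \<in> set rs" for r
    using that by fastforce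
  then show ?case
    using UApp.prems by (auto simp: map_idI split: uref.splits)
qed auto


section \<open>Locally nameless typing\<close>

text \<open>The context seen from inside a box: atoms are hidden, unknowns stay available.\<close>

definition unknowns_of :: "ctxt \<Rightarrow> ctxt" where
  "unknowns_of \<Gamma> = (\<lambda>n. case n of Inl a \<Rightarrow> None | Inr X \<Rightarrow> \<Gamma> (Inr X))"

lemma unknowns_of_simps [simp]:
  "unknowns_of \<Gamma> (Inl a) = None"
  "unknowns_of \<Gamma> (Inr X) = \<Gamma> (Inr X)"
  "unknowns_of (unknowns_of \<Gamma>) = unknowns_of \<Gamma>"
  "unknowns_of (\<Gamma>(Inr X \<mapsto> B)) = (unknowns_of \<Gamma>)(Inr X \<mapsto> B)"
  "unknowns_of (\<Gamma>(map Inl as [\<mapsto>] As)) = unknowns_of \<Gamma>"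
  by (auto simp: unknowns_of_def map_upds_map_Inl_Inr split: sum.splits)

definition uref_type :: "ty list \<Rightarrow> ctxt \<Rightarrow> uref \<Rightarrow> ty option" where
  "uref_type U \<Gamma> u =
     (case u of UFree X \<Rightarrow> \<Gamma> (Inr X) | UBound k \<Rightarrow> if k < length U then Some (U ! k) else None)"

lemma uref_type_simps [simp]:
  "uref_type U \<Gamma> (UFree X) = \<Gamma> (Inr X)"
  "uref_type U \<Gamma> (UBound k) = (if k < length U then Some (U ! k) else None)"
  "uref_type U (\<Gamma>(map Inl as [\<mapsto>] As)) u = uref_type U \<Gamma> u"
  by (simp_all add: uref_type_def map_upds_map_Inl_Inr split: uref.split)

text \<open>
  \<open>E ! k\<close> lists the types of the atoms bound at level \<open>k\<close>, and \<open>U ! k\<close> is the type of the unknown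
  bound at level \<open>k\<close>. The side condition of the box introduction rule becomes that the body of a box
  sees no atoms but those it binds.
\<close>

inductive ln_typing ::
  "ty set \<Rightarrow> ('c \<Rightarrow> ty) \<Rightarrow> ty list list \<Rightarrow> ty list \<Rightarrow> ctxt \<Rightarrow> 'c trm \<Rightarrow> ty \<Rightarrow> bool"
  for T :: "ty set" and tp :: "'c \<Rightarrow> ty"
where
  ln_Const: "ln_typing T tp E U \<Gamma> (Const c) (const_type tp c)"
| ln_FAtom: "\<Gamma> (Inl a) = Some A \<Longrightarrow> ln_typing T tp E U \<Gamma> (FAtom a) A"
| ln_BAtom: "k < length E \<Longrightarrow> i < length (E ! k) \<Longrightarrow> A = E ! k ! i \<Longrightarrow> ln_typing T tp E U \<Gamma> (BAtom k i) A"
| ln_LAM: "ln_typing T tp ([A] # E) U \<Gamma> r B \<Longrightarrow> ln_typing T tp E U \<Gamma> (LAM A r) (TyFun A B)"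
| ln_App: "ln_typing T tp E U \<Gamma> r (TyFun A B) \<Longrightarrow> ln_typing T tp E U \<Gamma> s A \<Longrightarrow> TyFun A B \<in> T
    \<Longrightarrow> ln_typing T tp E U \<Gamma> (App r s) B"
| ln_BOX: "ln_typing T tp [As] U (unknowns_of \<Gamma>) r A \<Longrightarrow> ln_typing T tp E U \<Gamma> (BOX As r) (TyBox As A)"
| ln_UApp: "uref_type U \<Gamma> u = Some (TyBox As A) \<Longrightarrow> length rs = length As
    \<Longrightarrow> (\<And>j. j < length As \<Longrightarrow> ln_typing T tp E U \<Gamma> (rs ! j) (As ! j)) \<Longrightarrow> TyBox As A \<in> T
    \<Longrightarrow> ln_typing T tp E U \<Gamma> (UApp u rs) A"
| ln_LET: "ln_typing T tp E U \<Gamma> s (TyBox As A) \<Longrightarrow> ln_typing T tp E (TyBox As A # U) \<Gamma> r B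
    \<Longrightarrow> ln_typing T tp E U \<Gamma> (LET s r) B"

inductive_cases ln_ConstE: "ln_typing T tp E U \<Gamma> (Const c) A"
inductive_cases ln_FAtomE: "ln_typing T tp E U \<Gamma> (FAtom a) A"
inductive_cases ln_BAtomE: "ln_typing T tp E U \<Gamma> (BAtom k i) A"
inductive_cases ln_LAME: "ln_typing T tp E U \<Gamma> (LAM B r) A"
inductive_cases ln_AppE: "ln_typing T tp E U \<Gamma> (App r s) A"
inductive_cases ln_BOXE: "ln_typing T tp E U \<Gamma> (BOX As r) A"
inductive_cases ln_UAppE: "ln_typing T tp E U \<Gamma> (UApp u rs) A"
inductive_cases ln_LETE: "ln_typing T tp E U \<Gamma> (LET s r) A"

section \<open>Free names, weakening and bounds on indices\<close>

lemma ln_typing_mono: "ln_typing T tp E U \<Gamma> r A \<Longrightarrow> T \<subseteq> T' \<Longrightarrow> ln_typing T' tp E U \<Gamma> r A"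
  by (induction rule: ln_typing.induct) (blast intro: ln_typing.intros)+

text \<open>Applied to the body of a box, whose context declares no atoms, this shows that the body
  has no free atoms at all.\<close>

lemma ln_typing_fa: "ln_typing T tp E U \<Gamma> r A \<Longrightarrow> a \<in> fa r \<Longrightarrow> \<Gamma> (Inl a) \<noteq> None"
proof (induction rule: ln_typing.induct)
  case (ln_UApp U \<Gamma> u As A rs E)
  then show ?case
    by (auto simp: in_set_conv_nth)
qed auto

text \<open>Indices count from the innermost binder, so entries appended at the outer ends of
  \<open>E\<close> and \<open>U\<close> shift no index; the context matters only at names free in
  the term.\<close>

lemma ln_typing_weaken:
  assumes "ln_typing T tp E U \<Gamma> r A"
    and "\<And>a. a \<in> fa r \<Longrightarrow> \<Delta> (Inl a) = \<Gamma> (Inl a)"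
    and "\<And>X. X \<in> fv r \<Longrightarrow> \<Delta> (Inr X) = \<Gamma> (Inr X)"
  shows "ln_typing T tp (E @ E') (U @ U') \<Delta> r A"
  using assms
proof (induction arbitrary: \<Delta> E' U' rule: ln_typing.induct)
  case (ln_BAtom k E i A U \<Gamma>)
  then show ?case
    by (intro ln_typing.ln_BAtom) (auto simp: nth_append)
next
  case (ln_BOX As U \<Gamma> r A E)
  \<comment> \<open>A box body is typed under exactly the level \<open>[As]\<close>, so nothing is
    appended to its atom levels. On atoms the two restricted contexts agree because both are
    undefined there.\<close>
  then show ?case
    using ln_BOX.IH[of "unknowns_of \<Delta>" "[]"] by (auto intro!: ln_typing.ln_BOX)
next
  case (ln_UApp U \<Gamma> u As A rs E)
  show ?case
  proof (rule ln_typing.ln_UApp)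
    show "uref_type (U @ U') \<Delta> u = Some (TyBox As A)"
      using ln_UApp.hyps(1) ln_UApp.prems(2) by (cases u) (auto simp: nth_append split: if_splits)
    show "ln_typing T tp (E @ E') (U @ U') \<Delta> (rs ! j) (As ! j)" if "j < length As" for j
      using that ln_UApp.hyps(2) ln_UApp.prems by (intro ln_UApp.IH) (auto, (metis nth_mem)+)
  qed (use ln_UApp.hyps in auto)
next
  case (ln_LET E U \<Gamma> s As A r B)
  then show ?case
    by (intro ln_typing.ln_LET[where As = As and A = A]) fastforce+
next
  case (ln_LAM A E U \<Gamma> r B)
  then show ?case
    by (intro ln_typing.ln_LAM) fastforce
next
  case (ln_App E U \<Gamma> r A B s)
  then show ?case
    by (intro ln_typing.ln_App[where A = A]) fastforce+
qed (auto intro: ln_typing.intros)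

text \<open>Every atom index of a typed term points into \<open>E\<close>. A box body has a single
  level, so opening a binder outside the box leaves it unchanged.\<close>

lemma ln_typing_aopen_id: "ln_typing T tp E U \<Gamma> r A \<Longrightarrow> length E \<le> k \<Longrightarrow> aopen k as r = r"
proof (induction arbitrary: k rule: ln_typing.induct)
  case (ln_UApp U \<Gamma> u As A rs E)
  then show ?case
    by (auto simp: list_eq_iff_nth_eq)
qed auto

section \<open>Opening and closing preserve typing\<close>

lemma ln_typing_aopen:
  assumes "ln_typing T tp (E @ [As]) U \<Gamma> r B"
    and as: "distinct as" "length as = length As" and "set as \<inter> fa r = {}"
  shows "ln_typing T tp E U (\<Gamma>(map Inl as [\<mapsto>] As)) (aopen (length E) as r) B"
  using assms(1,4)
\<comment> \<open>Binders crossed on the way extend \<open>E\<close> at its front, so the opened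
  level stays last and always has index \<open>length E\<close>.\<close>
proof (induction "E @ [As]" U \<Gamma> r B arbitrary: E rule: ln_typing.induct)
  case (ln_FAtom \<Gamma> a A U)
  then show ?case
    by (auto intro!: ln_typing.ln_FAtom simp: map_upds_map_Inl_notin)
next
  case (ln_BAtom k i A U \<Gamma>)
  show ?case
  proof (cases "k = length E")
    case True
    then show ?thesis
      using ln_BAtom as by (auto intro!: ln_typing.ln_FAtom simp: map_upds_map_nth inj_on_def)
  next
    case False
    then show ?thesis
      using ln_BAtom by (auto intro!: ln_typing.ln_BAtom simp: nth_append split: if_splits)
  qed
next
  case (ln_LAM A U \<Gamma> r B)
  then show ?case
    using ln_LAM.hyps(2)[of "[A] # E"] by (auto intro!: ln_typing.ln_LAM)
next
  case (ln_BOX As' U \<Gamma> r A)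
  then show ?case
    using ln_typing_aopen_id[OF ln_BOX.hyps(1)] by (auto intro!: ln_typing.ln_BOX)
next
  case (ln_UApp U \<Gamma> u As' A rs)
  have "ln_typing T tp E U (\<Gamma>(map Inl as [\<mapsto>] As)) (aopen (length E) as (rs ! j)) (As' ! j)"
    if "j < length As'" for j
  proof (rule ln_UApp.hyps(4)[OF that])
    have "rs ! j \<in> set rs"
      using that ln_UApp.hyps(2) by simp
    then show "set as \<inter> fa (rs ! j) = {}"
      using ln_UApp.prems by auto
  qed
  then show ?case
    using ln_UApp.hyps
    by (auto intro!: ln_typing.ln_UApp[where As = As'])
next
  case (ln_App U \<Gamma> r A B s)
  then show ?case
    by (auto intro!: ln_typing.ln_App[where A = A])
next
  case (ln_LET U \<Gamma> s As' A r B)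
  then show ?case
    by (auto intro!: ln_typing.ln_LET[where As = As' and A = A])
qed (auto intro: ln_typing.intros)

lemma ln_typing_aclose:
  assumes "ln_typing T tp E U (\<Gamma>(map Inl as [\<mapsto>] As)) r B"
    and as: "distinct as" "length as = length As"
  shows "ln_typing T tp (E @ [As]) U \<Gamma> (aclose (length E) as r) B"
  using assms(1)
proof (induction E U "\<Gamma>(map Inl as [\<mapsto>] As)" r B rule: ln_typing.induct)
  case (ln_FAtom a A E U)
  show ?case
  proof (rule map_upds_map_cases[of Inl as As "Inl a"])
    fix i
    assume "i < length As" "Inl a = (Inl (as ! i) :: atom + unknown)"
      "\<And>m. (m(map Inl as [\<mapsto>] As)) (Inl a :: atom + unknown) = Some (As ! i)"
    then show ?thesis
      using as ln_FAtom map_of_zip_index[of as i] by (auto intro!: ln_typing.ln_BAtom)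
  next
    assume "\<And>x. x \<in> set as \<Longrightarrow> Inl a \<noteq> (Inl x :: atom + unknown)"
      "\<And>m. (m(map Inl as [\<mapsto>] As)) (Inl a :: atom + unknown) = m (Inl a)"
    then have "aclose (length E) as (FAtom a :: 'a trm) = FAtom a" "\<Gamma> (Inl a) = Some A"
      using ln_FAtom by (force intro!: aclose_fresh simp del: aclose.simps)+
    then show ?thesis
      by (simp only: ln_typing.ln_FAtom)
  qed (use as in auto)
next
  case (ln_BAtom k E i A U)
  then show ?case
    by (auto intro!: ln_typing.ln_BAtom simp: nth_append)
next
  case (ln_BOX As' U r A E)
  \<comment> \<open>With no free atoms in the body, closing does not change it, and the update of
    the context is invisible to it; its typing carries over.\<close>
  have "fa r = {}"
    using ln_typing_fa[OF ln_BOX.hyps(1)] by auto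
  then show ?case
    using ln_BOX.hyps(1) by (auto intro!: ln_typing.ln_BOX simp: aclose_fresh)
next
  case (ln_UApp U u As' A rs E)
  then show ?case
    by (auto intro!: ln_typing.ln_UApp[where As = As'])
next
  case (ln_App E U r A B s)
  then show ?case
    by (auto intro!: ln_typing.ln_App[where A = A])
next
  case (ln_LET E U s As' A r B)
  then show ?case
    by (auto intro!: ln_typing.ln_LET[where As = As' and A = A])
qed (auto intro: ln_typing.intros)

text \<open>Unlike atoms, unknowns remain visible inside boxes. The induction therefore passes
  through box bodies, using that \<open>unknowns_of\<close> commutes with an update at an
  unknown.\<close>

lemma ln_typing_uopen:
  assumes "ln_typing T tp E (U @ [C]) \<Gamma> r B" and "X \<notin> fv r"
  shows "ln_typing T tp E U (\<Gamma>(Inr X \<mapsto> C)) (uopen (length U) X r) B"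
  using assms
proof (induction E "U @ [C]" \<Gamma> r B arbitrary: U rule: ln_typing.induct)
  case (ln_UApp \<Gamma> u As A rs E)
  have "uref_type U (\<Gamma>(Inr X \<mapsto> C)) (if u = UBound (length U) then UFree X else u) = Some (TyBox As A)"
    using ln_UApp.hyps(1) ln_UApp.prems by (cases u) (auto simp: nth_append split: if_splits)
  moreover have "ln_typing T tp E U (\<Gamma>(Inr X \<mapsto> C)) (uopen (length U) X (rs ! j)) (As ! j)"
    if "j < length As" for j
    using that ln_UApp.hyps(2) ln_UApp.prems by (intro ln_UApp.hyps(4)) auto
  ultimately show ?case
    using ln_UApp.hyps by (auto intro!: ln_typing.ln_UApp[where As = As])
next
  case (ln_App E \<Gamma> r A B s)
  then show ?case
    by (auto intro!: ln_typing.ln_App[where A = A])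
next
  case (ln_LET E \<Gamma> s As A r B)
  then show ?case
    using ln_LET.hyps(4)[of "TyBox As A # U"] by (auto intro!: ln_typing.ln_LET[where As = As and A = A])
qed (auto intro: ln_typing.intros)

lemma ln_typing_uclose:
  assumes "ln_typing T tp E U (\<Gamma>(Inr X \<mapsto> C)) r B"
  shows "ln_typing T tp E (U @ [C]) \<Gamma> (uclose (length U) X r) B"
  using assms
proof (induction E U "\<Gamma>(Inr X \<mapsto> C)" r B arbitrary: \<Gamma> rule: ln_typing.induct)
  case (ln_BAtom k E i A U)
  then show ?case
    by (auto intro!: ln_typing.ln_BAtom)
next
  case (ln_UApp U u As A rs E)
  have "uref_type (U @ [C]) \<Gamma> (if u = UFree X then UBound (length U) else u) = Some (TyBox As A)"
    using ln_UApp.hyps(1) by (cases u) (auto simp: nth_append split: if_splits)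
  then show ?case
    using ln_UApp.hyps by (auto intro!: ln_typing.ln_UApp[where As = As])
next
  case (ln_App E U r A B s)
  then show ?case
    by (auto intro!: ln_typing.ln_App[where A = A])
next
  case (ln_LET E U s As A r B)
  then show ?case
    by (auto intro!: ln_typing.ln_LET[where As = As and A = A])
qed (auto intro: ln_typing.intros)

section \<open>Equivalence of the named and the nameless judgement\<close>

lemma ln_typing_if_typing_in: "typing_in T tp \<Gamma> r A \<Longrightarrow> ln_typing T tp [] [] \<Gamma> r A"
proof (induction rule: typing_in.induct)
  case (FunI \<Gamma> a A r B)
  have "ln_typing T tp [[A]] [] \<Gamma> (aclose 0 [a] r) B"
    using ln_typing_aclose[of T tp "[]" "[]" \<Gamma> "[a]" "[A]" r B] FunI.IH by simp
  then show ?case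
    unfolding lam_def by (rule ln_LAM)
next
  case (BoxI as As \<Gamma> r A)
  \<comment> \<open>By the side condition of the rule all free atoms of \<open>r\<close> are among
    \<open>as\<close>, so weakening may discard the other atoms of the context, as the nameless box
    rule demands. The empty lists fit the shape of the weakening lemma.\<close>
  have "ln_typing T tp ([] @ []) ([] @ []) ((unknowns_of \<Gamma>)(map Inl as [\<mapsto>] As)) r A"
  proof (rule ln_typing_weaken[OF BoxI.IH])
    fix a assume "a \<in> fa r"
    then obtain i where "i < length As" "a = as ! i"
      using BoxI.hyps by (metis in_set_conv_nth subsetD)
    then show "((unknowns_of \<Gamma>)(map Inl as [\<mapsto>] As)) (Inl a) = (\<Gamma>(map Inl as [\<mapsto>] As)) (Inl a)"
      using BoxI.hyps by (simp add: map_upds_map_nth)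
  qed (simp add: map_upds_map_Inl_Inr)
  then show ?case
    using BoxI.hyps ln_typing_aclose[of T tp "[]" "[]" _ as As] by (auto simp: box_def intro: ln_BOX)
next
  case (BoxE \<Gamma> X As A r B s)
  have "ln_typing T tp [] [TyBox As A] \<Gamma> (uclose 0 X r) B"
    using ln_typing_uclose[OF BoxE.IH(1)] by simp
  with BoxE.IH(2) show ?case
    unfolding letbox_def by (rule ln_LET)
qed (auto intro: ln_typing.intros)

lemma ln_typing_LAM_open:
  assumes "ln_typing T tp [] [] \<Gamma> (LAM A r) C" and "a \<notin> fa r"
  obtains B where "C = TyFun A B" "ln_typing T tp [] [] (\<Gamma>(Inl a \<mapsto> A)) (aopen 0 [a] r) B"
  using assms ln_typing_aopen[of T tp "[]" "[A]" "[]" \<Gamma> r _ "[a]"] by (auto elim!: ln_LAME)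

text \<open>The opened body is typed twice: over the unknowns alone, for substitution inside the
  box, and over the whole context, for the extensional component of the denotation and for the named
  rule.\<close>

lemma ln_typing_BOX_open:
  assumes "ln_typing T tp [] [] \<Gamma> (BOX As r) C"
    and "distinct as" "length as = length As" "set as \<inter> fa r = {}"
  obtains A where "C = TyBox As A" "fa r = {}"
    "ln_typing T tp [] [] ((unknowns_of \<Gamma>)(map Inl as [\<mapsto>] As)) (aopen 0 as r) A"
    "ln_typing T tp [] [] (\<Gamma>(map Inl as [\<mapsto>] As)) (aopen 0 as r) A"
proof -
  from assms(1) obtain A where A: "C = TyBox As A" "ln_typing T tp [As] [] (unknowns_of \<Gamma>) r A"
    by (auto elim: ln_BOXE)
  have fa: "fa r = {}"
    using ln_typing_fa[OF A(2)] by auto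
  \<comment> \<open>The body has no free atoms, so restoring the atoms of \<open>\<Gamma>\<close> is
    an instance of weakening.\<close>
  have "ln_typing T tp ([As] @ []) ([] @ []) \<Gamma> r A"
    using fa by (intro ln_typing_weaken[OF A(2)]) auto
  then show thesis
    using that[OF A(1) fa] A(2) ln_typing_aopen[of T tp "[]" As "[]" _ r _ as] assms by simp
qed

lemma ln_typing_LET_open:
  assumes "ln_typing T tp [] [] \<Gamma> (LET s r) B" and "X \<notin> fv r"
  obtains As A where "ln_typing T tp [] [] \<Gamma> s (TyBox As A)"
    "ln_typing T tp [] [] (\<Gamma>(Inr X \<mapsto> TyBox As A)) (uopen 0 X r) B"
  using assms ln_typing_uopen[of T tp "[]" "[]"] by (auto elim!: ln_LETE)

text \<open>The induction is on \<open>tsize\<close> because an opened body is not a subterm. At a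
  binder the body is opened with fresh names, typed by the induction hypothesis, and closed again,
  which gives back the original term.\<close>

lemma typing_in_if_ln_typing: "ln_typing T tp [] [] \<Gamma> r A \<Longrightarrow> typing_in T tp \<Gamma> r A"
proof (induction "tsize r" arbitrary: r \<Gamma> A rule: less_induct)
  case less
  show ?case
  proof (cases r)
    case (Const c)
    then show ?thesis
      using less.prems by (auto elim: ln_ConstE intro: typing_in.intros)
  next
    case (FAtom a)
    then show ?thesis
      using less.prems by (auto elim: ln_FAtomE intro: typing_in.intros)
  next
    case (BAtom k i)
    then show ?thesis
      using less.prems by (auto elim: ln_BAtomE)
  next
    case (LAM A' s)
    obtain a where a: "a \<notin> fa s"
      using ex_new_if_finite[OF infinite_atoms finite_fa] by blast
    from less.prems LAM a obtain B where B: "A = TyFun A' B"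
      "ln_typing T tp [] [] (\<Gamma>(Inl a \<mapsto> A')) (aopen 0 [a] s) B"
      by (auto elim: ln_typing_LAM_open)
    then have "typing_in T tp \<Gamma> (lam a A' (aopen 0 [a] s)) A"
      using less.hyps[OF _ B(2)] LAM by (auto intro: typing_in.FunI)
    then show ?thesis
      using LAM a by (simp add: lam_def aclose_aopen)
  next
    case (App s t)
    from less.prems[unfolded App] obtain B where B: "ln_typing T tp [] [] \<Gamma> s (TyFun B A)"
      "ln_typing T tp [] [] \<Gamma> t B" "TyFun B A \<in> T"
      by (rule ln_AppE)
    show ?thesis
      using App less.hyps[OF _ B(1)] less.hyps[OF _ B(2)] B(3) by (auto intro: typing_in.FunE)
  next
    case (BOX As s)
    define as where "as = fresh_atoms (length As) (fa s)"
    have as: "distinct as" "length as = length As" "set as \<inter> fa s = {}"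
      using fresh_atoms[OF finite_fa, of "length As" s] by (simp_all add: as_def)
    from less.prems[unfolded BOX] as obtain B where B: "A = TyBox As B" "fa s = {}"
      "ln_typing T tp [] [] (\<Gamma>(map Inl as [\<mapsto>] As)) (aopen 0 as s) B"
      by (rule ln_typing_BOX_open)
    \<comment> \<open>The side condition of the box rule holds because the body has no free atoms,
      so that opening introduces only those in \<open>as\<close>.\<close>
    have "typing_in T tp \<Gamma> (box as As (aopen 0 as s)) A"
      using less.hyps[OF _ B(3)] BOX as fa_aopen[of 0 as s] B by (auto intro!: typing_in.BoxI)
    then show ?thesis
      using BOX as by (simp add: box_def aclose_aopen)
  next
    case (UApp u rs)
    from less.prems[unfolded UApp] obtain X As where "u = UFree X" "\<Gamma> (Inr X) = Some (TyBox As A)"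
      "length rs = length As" "TyBox As A \<in> T"
      "\<And>j. j < length As \<Longrightarrow> ln_typing T tp [] [] \<Gamma> (rs ! j) (As ! j)"
      by (cases u) (auto elim!: ln_UAppE)
    then show ?thesis
      using UApp less.hyps by (auto intro!: typing_in.Ext simp: tsize_arg)
  next
    case (LET s t)
    obtain X where X: "X \<notin> fv t"
      using ex_new_if_finite[OF infinite_unknowns finite_fv] by blast
    from less.prems[unfolded LET] X obtain As B where B: "ln_typing T tp [] [] \<Gamma> s (TyBox As B)"
      "ln_typing T tp [] [] (\<Gamma>(Inr X \<mapsto> TyBox As B)) (uopen 0 X t) A"
      by (rule ln_typing_LET_open)
    have "typing_in T tp \<Gamma> (letbox X s (uopen 0 X t)) A"
      using less.hyps[OF _ B(1)] less.hyps[OF _ B(2)] LET by (auto intro!: typing_in.BoxE)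
    then show ?thesis
      using LET X by (simp add: letbox_def uclose_uopen)
  qed
qed


section \<open>Substitution preserves types\<close>

text \<open>Substituted terms have no dangling indices, so weakening carries them under any binder
  without capture. In a box body the condition on atoms is vacuous.\<close>

lemma ln_typing_asubst:
  assumes "ln_typing T tp E U \<Gamma> r A"
    and "\<And>a B. \<Gamma> (Inl a) = Some B \<Longrightarrow>
      (case \<sigma> a of None \<Rightarrow> \<Delta> (Inl a) = Some B | Some t \<Rightarrow> ln_typing T tp [] [] \<Delta> t B)"
    and "\<And>X B. \<Gamma> (Inr X) = Some B \<Longrightarrow> \<Delta> (Inr X) = Some B"
  shows "ln_typing T tp E U \<Delta> (asubst \<sigma> r) A"
  using assms
proof (induction arbitrary: \<Delta> rule: ln_typing.induct)
  case (ln_FAtom \<Gamma> a A E U)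
  then show ?case
    using ln_FAtom.prems(1)[OF ln_FAtom.hyps] ln_typing_weaken[of T tp "[]" "[]" \<Delta> _ A \<Delta> E U]
    by (cases "\<sigma> a") (simp_all add: ln_typing.ln_FAtom)
next
  case (ln_UApp U \<Gamma> u As A rs E)
  have "uref_type U \<Delta> u = Some (TyBox As A)"
    using ln_UApp.hyps(1) ln_UApp.prems(2) by (cases u) auto
  then show ?case
    using ln_UApp by (auto intro!: ln_typing.ln_UApp[where As = As])
next
  case (ln_App E U \<Gamma> r A B s)
  then show ?case
    by (auto intro!: ln_typing.ln_App[where A = A])
next
  case (ln_LET E U \<Gamma> s As A r B)
  then show ?case
    by (auto intro!: ln_typing.ln_LET[where As = As and A = A])
qed (auto intro: ln_typing.intros)

text \<open>The replacements are closed boxes, hence usable in every context;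
  \<open>\<Delta>\<close> has to retain only the atoms and the unsubstituted unknowns of
  \<open>\<Gamma>\<close>. The induction on \<open>tsize\<close> follows the recursion of
  \<open>usubst\<close>, opening binders with the names it picks.\<close>

lemma ln_typing_usubst:
  assumes "ln_typing T tp [] [] \<Gamma> r A" and "finite (dom \<theta>)"
    and "\<And>a B. \<Gamma> (Inl a) = Some B \<Longrightarrow> \<Delta> (Inl a) = Some B"
    and "\<And>X B. \<Gamma> (Inr X) = Some B \<Longrightarrow> \<theta> X = None \<Longrightarrow> \<Delta> (Inr X) = Some B"
    and "\<And>X B t. \<Gamma> (Inr X) = Some B \<Longrightarrow> \<theta> X = Some t \<Longrightarrow> ln_typing T tp [] [] Map.empty t B"
    and box: "\<And>X t. \<theta> X = Some t \<Longrightarrow> \<exists>As s. t = BOX As s"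
  shows "ln_typing T tp [] [] \<Delta> (usubst \<theta> r) A"
  using assms(1,3-5)
proof (induction "tsize r" arbitrary: r \<Gamma> \<Delta> A rule: less_induct)
  case less
  show ?case
  proof (cases r)
    case (Const c)
    then show ?thesis
      using less.prems by (auto elim: ln_ConstE intro: ln_typing.intros)
  next
    case (FAtom a)
    then show ?thesis
      using less.prems by (auto elim: ln_FAtomE intro: ln_typing.intros)
  next
    case (BAtom k i)
    then show ?thesis
      using less.prems by (auto elim: ln_BAtomE)
  next
    case (LAM A' s)
    define as where "as = fresh_atoms (Suc 0) (fa s)"
    have "length as = 1" "set as \<inter> fa s = {}"
      using fresh_atoms[OF finite_fa, of "Suc 0" s] by (simp_all add: as_def)
    then obtain a where a: "as = [a]" "a \<notin> fa s"
      by (cases as) auto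
    from less.prems(1)[unfolded LAM] a(2) obtain B where B: "A = TyFun A' B"
      "ln_typing T tp [] [] (\<Gamma>(Inl a \<mapsto> A')) (aopen 0 [a] s) B"
      by (rule ln_typing_LAM_open)
    have "ln_typing T tp [] [] (\<Delta>(Inl a \<mapsto> A')) (usubst \<theta> (aopen 0 [a] s)) B"
      using LAM less.prems by (intro less.hyps[OF _ B(2)]) (simp_all split: if_splits)
    then have "ln_typing T tp [[A']] [] \<Delta> (aclose 0 [a] (usubst \<theta> (aopen 0 [a] s))) B"
      using ln_typing_aclose[of T tp "[]" "[]" \<Delta> "[a]" "[A']"] by simp
    then show ?thesis
      using LAM B a by (auto simp: as_def[symmetric] Let_def lam_def intro: ln_LAM)
  next
    case (App s t)
    from less.prems(1)[unfolded App] obtain B where B: "ln_typing T tp [] [] \<Gamma> s (TyFun B A)"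
      "ln_typing T tp [] [] \<Gamma> t B" "TyFun B A \<in> T"
      by (rule ln_AppE)
    have "ln_typing T tp [] [] \<Delta> (usubst \<theta> s) (TyFun B A)" "ln_typing T tp [] [] \<Delta> (usubst \<theta> t) B"
      using App less.prems(2-4) by (auto intro: less.hyps[OF _ B(1)] less.hyps[OF _ B(2)])
    then show ?thesis
      using App B(3) by (auto intro: ln_App)
  next
    case (BOX As s)
    define as where "as = fresh_atoms (length As) (fa s)"
    have as: "distinct as" "length as = length As" "set as \<inter> fa s = {}"
      using fresh_atoms[OF finite_fa, of "length As" s] by (simp_all add: as_def)
    from less.prems(1)[unfolded BOX] as obtain B where B: "A = TyBox As B" "fa s = {}"
      "ln_typing T tp [] [] ((unknowns_of \<Gamma>)(map Inl as [\<mapsto>] As)) (aopen 0 as s) B"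
      by (rule ln_typing_BOX_open)
    have "ln_typing T tp [] [] ((unknowns_of \<Delta>)(map Inl as [\<mapsto>] As)) (usubst \<theta> (aopen 0 as s)) B"
    proof (rule less.hyps[OF _ B(3)])
      fix a C
      assume C: "((unknowns_of \<Gamma>)(map Inl as [\<mapsto>] As)) (Inl a) = Some C"
      \<comment> \<open>A bound atom gets the same type in both contexts; at any other atom
        \<open>unknowns_of \<Gamma>\<close> is undefined, contradicting \<open>C\<close>.\<close>
      show "((unknowns_of \<Delta>)(map Inl as [\<mapsto>] As)) (Inl a) = Some C"
        by (rule map_upds_map_cases[of Inl as As "Inl a :: atom + unknown"]) (use as C in auto)
    qed (use BOX less.prems(3,4) in \<open>auto simp: map_upds_map_Inl_Inr\<close>)
    then have "ln_typing T tp [As] [] (unknowns_of \<Delta>) (aclose 0 as (usubst \<theta> (aopen 0 as s))) B"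
      using ln_typing_aclose[of T tp "[]" "[]" _ as As] as by simp
    then show ?thesis
      using BOX B(1) by (auto simp: as_def[symmetric] Let_def box_def intro: ln_BOX)
  next
    case (UApp u rs)
    from less.prems(1)[unfolded UApp] obtain X As where X: "u = UFree X" "\<Gamma> (Inr X) = Some (TyBox As A)"
      "length rs = length As" "TyBox As A \<in> T"
      "\<And>j. j < length As \<Longrightarrow> ln_typing T tp [] [] \<Gamma> (rs ! j) (As ! j)"
      by (cases u) (auto elim!: ln_UAppE)
    have args: "ln_typing T tp [] [] \<Delta> (usubst \<theta> (rs ! j)) (As ! j)" if "j < length As" for j
      using that X UApp less.prems by (intro less.hyps[OF _ X(5)]) (auto simp: tsize_arg)
    show ?thesis
    proof (cases "\<theta> X")
      case None
      then have "\<Delta> (Inr X) = Some (TyBox As A)"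
        using less.prems(3)[OF X(2)] by simp
      then show ?thesis
        using UApp X None args by (auto intro!: ln_UApp[where As = As])
    next
      case (Some t)
      then have "ln_typing T tp [] [] Map.empty t (TyBox As A)"
        by (rule less.prems(4)[OF X(2)])
      moreover obtain As' s where "t = BOX As' s"
        using box Some by blast
      \<comment> \<open>Inversion forces the annotation \<open>As'\<close> to be \<open>As\<close>,
        so the arities match and \<open>usubst\<close> takes its substituting branch.\<close>
      ultimately have t: "t = BOX As s" and s: "ln_typing T tp [] [] Map.empty (BOX As s) (TyBox As A)"
        by (auto elim: ln_BOXE)
      define as where "as = fresh_atoms (length As) (fa s)"
      have as: "distinct as" "length as = length As" "set as \<inter> fa s = {}"
        using fresh_atoms[OF finite_fa, of "length As" s] by (simp_all add: as_def)
      from s as have open_s: "ln_typing T tp [] [] (Map.empty(map Inl as [\<mapsto>] As)) (aopen 0 as s) A"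
        by (rule ln_typing_BOX_open) simp
      let ?\<sigma> = "[as [\<mapsto>] map (usubst \<theta>) rs]"
      have "ln_typing T tp [] [] \<Delta> (asubst ?\<sigma> (aopen 0 as s)) A"
      proof (rule ln_typing_asubst[OF open_s])
        fix a B
        assume B: "(Map.empty(map Inl as [\<mapsto>] As)) (Inl a :: atom + unknown) = Some B"
        show "case ?\<sigma> a of None \<Rightarrow> \<Delta> (Inl a) = Some B | Some t \<Rightarrow> ln_typing T tp [] [] \<Delta> t B"
        proof (rule map_upds_map_cases[of Inl as As "Inl a :: atom + unknown"])
          fix i
          assume i: "i < length As" "Inl a = (Inl (as ! i) :: atom + unknown)"
            "\<And>m. (m(map Inl as [\<mapsto>] As)) (Inl a :: atom + unknown) = Some (As ! i)"
          \<comment> \<open>The substitution is itself an update of the empty map, so the lookup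
            lemma applies with the identity as \<open>f\<close>.\<close>
          have "?\<sigma> (as ! i) = Some (usubst \<theta> (rs ! i))"
            using map_upds_map_nth[of "\<lambda>x. x" as "map (usubst \<theta>) rs" i Map.empty] as X(3) i(1) by simp
          then show ?thesis
            using i B args[OF i(1)] by simp
        qed (use as B in auto)
      qed (simp add: map_upds_map_Inl_Inr)
      then show ?thesis
        using UApp X(1,3) Some t by (simp add: as_def[symmetric] Let_def)
    qed
  next
    case (LET s t)
    define Y where "Y = fresh_unknown (fv t \<union> fv_sub \<theta>)"
    have "finite (fv_sub \<theta>)"
      using assms(2) by (simp add: fv_sub_def finite_ran finite_fv)
    then have Y: "Y \<notin> fv t" "Y \<notin> dom \<theta>"
      using fresh_unknown[of "fv t \<union> fv_sub \<theta>"] by (auto simp: Y_def finite_fv fv_sub_def)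
    from less.prems(1)[unfolded LET] Y(1) obtain As B where B: "ln_typing T tp [] [] \<Gamma> s (TyBox As B)"
      "ln_typing T tp [] [] (\<Gamma>(Inr Y \<mapsto> TyBox As B)) (uopen 0 Y t) A"
      by (rule ln_typing_LET_open)
    \<comment> \<open>As \<open>Y\<close> lies outside the domain of \<open>\<theta>\<close>, its
      new declaration falls under the hypothesis on unsubstituted unknowns.\<close>
    have "ln_typing T tp [] [] (\<Delta>(Inr Y \<mapsto> TyBox As B)) (usubst \<theta> (uopen 0 Y t)) A"
      using LET less.prems(2-4) Y(2) by (intro less.hyps[OF _ B(2)]) (auto split: if_splits)
    then have "ln_typing T tp [] [TyBox As B] \<Delta> (uclose 0 Y (usubst \<theta> (uopen 0 Y t))) A"
      using ln_typing_uclose[of T tp "[]" "[]"] by simp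
    moreover have "ln_typing T tp [] [] \<Delta> (usubst \<theta> s) (TyBox As B)"
      using LET less.prems by (intro less.hyps[OF _ B(1)]) auto
    ultimately show ?thesis
      using LET by (auto simp: Y_def[symmetric] Let_def letbox_def intro: ln_LET)
  qed
qed


section \<open>Soundness\<close>

lemma in_listset_iff: "xs \<in> listset Ds \<longleftrightarrow> list_all2 (\<in>) xs Ds"
  by (induction Ds arbitrary: xs) (auto simp: set_Cons_def list_all2_Cons2)

lemma restrict_fun_in_funs:
  "(\<And>xs. list_all2 (\<in>) xs Ds \<Longrightarrow> F xs \<in> D) \<Longrightarrow> restrict_fun F Ds \<in> funs Ds D"
  by (auto simp: funs_def restrict_fun_def ran_def in_listset_iff split: if_splits)

lemma the_funs_in:
  assumes "f \<in> funs Ds D" "list_all2 (\<in>) xs Ds"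
  shows "the (f xs) \<in> D"
proof -
  have "xs \<in> dom f"
    using assms by (simp add: funs_def in_listset_iff)
  then obtain y where "f xs = Some y"
    by blast
  then show ?thesis
    using assms(1) by (auto simp: funs_def dest: ranI)
qed

text \<open>Membership of the applied type in \<open>T\<close> lets decoding recover the coded
  function. This is where \<open>represents\<close> enters the proof.\<close>

lemma apply_val_in_ty_den:
  assumes "represents tp M T"
  shows "v \<in> ty_den tp M (TyFun A B) \<Longrightarrow> TyFun A B \<in> T \<Longrightarrow> x \<in> ty_den tp M A
      \<Longrightarrow> apply_val M v [x] \<in> ty_den tp M B"
    and "v \<in> ty_den tp M (TyBox As B) \<Longrightarrow> TyBox As B \<in> T \<Longrightarrow> list_all2 (\<in>) xs (map (ty_den tp M) As)
      \<Longrightarrow> apply_val M v xs \<in> ty_den tp M B"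
proof -
  have decode: "decode M (code M f) = f" if "f \<in> fun_space tp M C" "C \<in> T" for f C
    using assms that by (auto simp: represents_def)
  show "apply_val M v [x] \<in> ty_den tp M B"
    if "v \<in> ty_den tp M (TyFun A B)" "TyFun A B \<in> T" "x \<in> ty_den tp M A"
    using that decode[of _ "TyFun A B"] the_funs_in by (fastforce simp: apply_val_def)
  show "apply_val M v xs \<in> ty_den tp M B"
    if "v \<in> ty_den tp M (TyBox As B)" "TyBox As B \<in> T" "list_all2 (\<in>) xs (map (ty_den tp M) As)"
    using that decode[of _ "TyBox As B"] the_funs_in by (fastforce simp: apply_val_def)
qed

lemma const_den_in_ty_den:
  assumes "const_ok tp M"
  shows "const_den tp M c \<in> ty_den tp M (const_type tp c)"
proof (cases c)
  case (CIsapp A)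
  let ?D = "ty_den tp M (TyBox [] A)"
  have "restrict_fun (\<lambda>xs. VBool (is_app_box (hd xs))) [?D] \<in> funs [?D] (ty_den tp M TyO)"
    by (rule restrict_fun_in_funs) auto
  \<comment> \<open>Only the arrow clause of \<open>ty_den\<close> is unfolded, so that the box
    denotation \<open>?D\<close> stays opaque.\<close>
  then show ?thesis
    unfolding CIsapp const_den.simps const_type.simps ty_den.simps(3) by blast
qed (use assms in \<open>auto simp: const_ok_def\<close>)

section \<open>Contexts and valuations under extension\<close>

lemma is_ctxt_updates:
  assumes "is_ctxt \<Gamma>"
  shows "is_ctxt (\<Gamma>(Inl a \<mapsto> A))" "is_ctxt (\<Gamma>(Inr X \<mapsto> TyBox As A))" "is_ctxt (\<Gamma>(map Inl as [\<mapsto>] As))"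
  using assms by (auto simp: is_ctxt_def map_upds_map_Inl_Inr)

lemma val_ok_upd:
  "val_ok tp M \<Gamma> \<zeta> \<Longrightarrow> v \<in> ty_den tp M A \<Longrightarrow> val_ok tp M (\<Gamma>(n \<mapsto> A)) (\<zeta>(n \<mapsto> v))"
  by (auto simp: val_ok_def split: if_splits)

text \<open>As \<open>As\<close> and \<open>vs\<close> have equal length, truncation in
  \<open>map_upds\<close> affects both updates alike.\<close>

lemma val_ok_upds:
  assumes "val_ok tp M \<Gamma> \<zeta>" "list_all2 (\<in>) vs (map (ty_den tp M) As)"
  shows "val_ok tp M (\<Gamma>(ns [\<mapsto>] As)) (\<zeta>(ns [\<mapsto>] vs))"
  using assms
proof (induction ns arbitrary: \<Gamma> \<zeta> As vs)
  case (Cons n ns)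
  then show ?case
    by (cases As; cases vs) (auto intro: Cons.IH val_ok_upd)
qed simp

lemma val_ok_lookup:
  assumes "val_ok tp M \<Gamma> \<zeta>" "\<Gamma> n = Some A"
  obtains v where "\<zeta> n = Some v" "v \<in> ty_den tp M A"
proof -
  have "n \<in> dom \<zeta>"
    using assms by (auto simp: val_ok_def)
  then show thesis
    using assms that by (auto simp: val_ok_def)
qed

text \<open>This gives the intensional component of a box denotation. Every unknown of the context
  holds a \<open>VBox\<close> whose head is a closed typed box, so \<open>hd_subst \<zeta>\<close>
  replaces them all and leaves a closed term.\<close>

lemma usubst_hd_subst_closed:
  assumes "ln_typing T tp [] [] \<Gamma> (BOX As r) B" "is_ctxt \<Gamma>" "val_ok tp M \<Gamma> \<zeta>"
  shows "typing tp Map.empty (usubst (hd_subst \<zeta>) (BOX As r)) B"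
proof (rule typing_in_if_ln_typing, rule ln_typing_usubst)
  \<comment> \<open>The heads are known to be typable only in the plain judgement, hence the passage
    to \<open>UNIV\<close>. Dropping the atoms, which a box does not see, allows the empty target
    context.\<close>
  show "ln_typing UNIV tp [] [] (unknowns_of \<Gamma>) (BOX As r) B"
    using ln_typing_mono[OF assms(1) subset_UNIV] by (auto elim!: ln_BOXE intro!: ln_BOX)
  have "dom (hd_subst \<zeta>) \<subseteq> Inr -` dom \<Gamma>"
    using assms(3) by (auto simp: hd_subst_def val_ok_def split: option.splits)
  moreover have "finite (Inr -` dom \<Gamma>)"
    using assms(2) by (auto simp: is_ctxt_def intro: finite_vimageI)
  ultimately show "finite (dom (hd_subst \<zeta>))"
    by (rule finite_subset)
next
  fix X C
  assume "unknowns_of \<Gamma> (Inr X) = Some C"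
  then have "\<Gamma> (Inr X) = Some C"
    by simp
  moreover from this obtain As' A where "C = TyBox As' A"
    using assms(2) by (metis is_ctxt_def)
  ultimately obtain v where "\<zeta> (Inr X) = Some v" "v \<in> ty_den tp M (TyBox As' A)" "C = TyBox As' A"
    using assms(3) by (auto elim: val_ok_lookup)
  \<comment> \<open>The first claim has a false premise: a value of box type is a
    \<open>VBox\<close>, so \<open>hd_subst\<close> is defined at \<open>X\<close>.\<close>
  then show "hd_subst \<zeta> X = None \<Longrightarrow> Map.empty (Inr X) = Some C"
    and "\<And>t. hd_subst \<zeta> X = Some t \<Longrightarrow> ln_typing UNIV tp [] [] Map.empty t C"
    by (auto simp: hd_subst_def intro: ln_typing_if_typing_in)
next
  fix X t
  assume t: "hd_subst \<zeta> X = Some t"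
  then obtain u where u: "\<zeta> (Inr X) = Some (VBox t u)"
    by (auto simp: hd_subst_def split: option.splits val.splits)
  \<comment> \<open>The equal domains give \<open>X\<close> a declared type, contextual by
    \<open>is_ctxt\<close>, and values of such a type have a \<open>BOX\<close> as head.\<close>
  then have "Inr X \<in> dom \<Gamma>"
    using assms(3) by (auto simp: val_ok_def)
  then obtain As' A where "\<Gamma> (Inr X) = Some (TyBox As' A)"
    using assms(2) unfolding is_ctxt_def by blast
  with assms(3) obtain v where "\<zeta> (Inr X) = Some v" "v \<in> ty_den tp M (TyBox As' A)"
    by (rule val_ok_lookup)
  then show "\<exists>As s. t = BOX As s"
    using u by auto
qed simp

text \<open>Induction on \<open>tsize\<close> mirrors the recursion of \<open>den\<close>. Whatever
  fresh names \<open>den\<close> picks, the inversion lemmas type the body opened with those names,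
  while context and valuation are extended alike.\<close>

lemma ln_typing_sound:
  assumes "represents tp M T" "const_ok tp M"
    and "ln_typing T tp [] [] \<Gamma> r A" "is_ctxt \<Gamma>" "val_ok tp M \<Gamma> \<zeta>"
  shows "den tp M \<zeta> r \<in> ty_den tp M A"
  using assms(3-5)
proof (induction "tsize r" arbitrary: r \<Gamma> \<zeta> A rule: less_induct)
  case less
  show ?case
  proof (cases r)
    case (Const c)
    then show ?thesis
      using less.prems const_den_in_ty_den[OF assms(2)] by (auto elim!: ln_ConstE)
  next
    case (FAtom a)
    then show ?thesis
      using less.prems by (auto elim!: ln_FAtomE elim: val_ok_lookup)
  next
    case (BAtom k i)
    then show ?thesis
      using less.prems by (auto elim: ln_BAtomE)
  next
    case (LAM A' s)
    define as where "as = fresh_atoms (Suc 0) (fa s)"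
    have "length as = 1" "set as \<inter> fa s = {}"
      using fresh_atoms[OF finite_fa, of "Suc 0" s] by (simp_all add: as_def)
    then obtain a where a: "as = [a]" "a \<notin> fa s"
      by (cases as) auto
    from less.prems(1)[unfolded LAM] a(2) obtain B where B: "A = TyFun A' B"
      "ln_typing T tp [] [] (\<Gamma>(Inl a \<mapsto> A')) (aopen 0 [a] s) B"
      by (rule ln_typing_LAM_open)
    have "restrict_fun (\<lambda>xs. den tp M (\<zeta>(Inl a \<mapsto> hd xs)) (aopen 0 [a] s)) [ty_den tp M A']
        \<in> funs [ty_den tp M A'] (ty_den tp M B)"
    proof (rule restrict_fun_in_funs)
      fix xs
      assume "list_all2 (\<in>) xs [ty_den tp M A']"
      then have "hd xs \<in> ty_den tp M A'"
        by (auto simp: list_all2_Cons2)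
      then show "den tp M (\<zeta>(Inl a \<mapsto> hd xs)) (aopen 0 [a] s) \<in> ty_den tp M B"
        using LAM less.prems by (intro less.hyps[OF _ B(2)] is_ctxt_updates val_ok_upd) auto
    qed
    then show ?thesis
      using LAM B(1) a(1) by (auto simp: as_def[symmetric])
  next
    case (App s t)
    from less.prems(1)[unfolded App] obtain B where B: "ln_typing T tp [] [] \<Gamma> s (TyFun B A)"
      "ln_typing T tp [] [] \<Gamma> t B" "TyFun B A \<in> T"
      by (rule ln_AppE)
    have "den tp M \<zeta> s \<in> ty_den tp M (TyFun B A)" "den tp M \<zeta> t \<in> ty_den tp M B"
      using App less.prems less.hyps[OF _ B(1)] less.hyps[OF _ B(2)] by simp_all
    then show ?thesis
      using App apply_val_in_ty_den(1)[OF assms(1) _ B(3)] by simp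
  next
    case (BOX As s)
    define as where "as = fresh_atoms (length As) (fa s)"
    have as: "distinct as" "length as = length As" "set as \<inter> fa s = {}"
      using fresh_atoms[OF finite_fa, of "length As" s] by (simp_all add: as_def)
    from less.prems(1)[unfolded BOX] as obtain B where B: "A = TyBox As B"
      "ln_typing T tp [] [] (\<Gamma>(map Inl as [\<mapsto>] As)) (aopen 0 as s) B"
      by (rule ln_typing_BOX_open)
    have "restrict_fun (\<lambda>xs. den tp M (\<zeta>(map Inl as [\<mapsto>] xs)) (aopen 0 as s)) (map (ty_den tp M) As)
        \<in> funs (map (ty_den tp M) As) (ty_den tp M B)"
      using BOX less.prems
      by (intro restrict_fun_in_funs less.hyps[OF _ B(2)] is_ctxt_updates val_ok_upds) auto
    \<comment> \<open>\<open>den\<close> and the box clause of \<open>usubst\<close> choose the same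
      names, so this component is literally
      \<open>usubst (hd_subst \<zeta>) (BOX As s)\<close>.\<close>
    moreover have "typing tp Map.empty (box as As (usubst (hd_subst \<zeta>) (aopen 0 as s))) (TyBox As B)"
      using usubst_hd_subst_closed[of T tp \<Gamma> As s A M \<zeta>] less.prems BOX B(1)
      by (simp add: as_def Let_def)
    ultimately show ?thesis
      using BOX B(1) by (auto simp: as_def[symmetric] Let_def box_def)
  next
    case (UApp u rs)
    from less.prems(1)[unfolded UApp] obtain X As where X: "u = UFree X" "\<Gamma> (Inr X) = Some (TyBox As A)"
      "length rs = length As" "TyBox As A \<in> T"
      "\<And>j. j < length As \<Longrightarrow> ln_typing T tp [] [] \<Gamma> (rs ! j) (As ! j)"
      by (cases u) (auto elim!: ln_UAppE)
    from less.prems(3) X(2) obtain v where v: "\<zeta> (Inr X) = Some v" "v \<in> ty_den tp M (TyBox As A)"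
      by (rule val_ok_lookup)
    have "den tp M \<zeta> (rs ! j) \<in> ty_den tp M (As ! j)" if "j < length As" for j
      using that X UApp less.prems by (intro less.hyps[OF _ X(5)]) (auto simp: tsize_arg)
    then have "list_all2 (\<in>) (map (den tp M \<zeta>) rs) (map (ty_den tp M) As)"
      using X(3) by (simp add: list_all2_conv_all_nth)
    then show ?thesis
      using UApp X(1,4) v apply_val_in_ty_den(2)[OF assms(1)] by simp
  next
    case (LET s t)
    define X where "X = fresh_unknown (fv t)"
    have "X \<notin> fv t"
      by (simp add: X_def fresh_unknown finite_fv)
    with less.prems(1)[unfolded LET] obtain As B where B: "ln_typing T tp [] [] \<Gamma> s (TyBox As B)"
      "ln_typing T tp [] [] (\<Gamma>(Inr X \<mapsto> TyBox As B)) (uopen 0 X t) A"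
      by (rule ln_typing_LET_open)
    have "den tp M \<zeta> s \<in> ty_den tp M (TyBox As B)"
      using LET less.prems by (intro less.hyps[OF _ B(1)]) auto
    then have "den tp M (\<zeta>(Inr X \<mapsto> den tp M \<zeta> s)) (uopen 0 X t) \<in> ty_den tp M A"
      using LET less.prems by (intro less.hyps[OF _ B(2)] is_ctxt_updates val_ok_upd) auto
    then show ?thesis
      using LET by (simp add: X_def[symmetric] Let_def)
  qed
qed

text \<open>\<open>T = UNIV\<close> gives plain typability; by \<open>typing_imp_finite\<close>
  every plain derivation is also covered by some finite \<open>T\<close>.\<close>

theorem theorem6p10:
  fixes tp :: "'c \<Rightarrow> ty"
    and M :: "('c, 'u) model"
    and T :: "ty set"
    and \<Gamma> :: ctxt
    and r :: "'c trm"
    and A :: ty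
    and \<zeta> :: "('c, 'u) valuation"
  assumes "represents tp M T"
    and "const_ok tp M"
    and "is_ctxt \<Gamma>"
    and "typing_in T tp \<Gamma> r A"
    and "val_ok tp M \<Gamma> \<zeta>"
  shows "den tp M \<zeta> r \<in> ty_den tp M A"
  using ln_typing_sound[OF assms(1,2) ln_typing_if_typing_in[OF assms(4)] assms(3,5)] .

end
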